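(* Let $\omega$ be a multiplicative 2-cocycle on the pentachoron $u=12345$ with values in $\mathbb C^*$ that never takes the value $-1$. Then a two-boson pentachoron weight corresponding to $\omega$ always exists; in particular, it can be chosen in the form of a product of five delta functions $\prod_{i=1}^5\delta(\ell_i)$ of linearly independent linear forms $\ell_i$ in the ten variables $x_t,y_t$.
   Context: Let $u=12345$ be a pentachoron (4-simplex); its tetrahedra $t$ are the 4-element subsets and its edges $b=ij$ the 2-element subsets of $\{1,\dots,5\}$. A multiplicative 2-cocycle assigns to each oriented triangle $s=ijk$ a number $\omega_s\in\mathbb C^*$ with $\omega_{-s}=\omega_s^{-1}$ for the opposite orientation and $\omega_{ijk}\omega_{ikl}=\omega_{ijl}\omega_{jkl}$ for all distinct $i,j,k,l$. To each $t$ attach two complex variables $x_t,y_t$ and the space of operators $V_t=\mathrm{span}_{\mathbb C}\{\partial/\partial x_t,\partial/\partial y_t,x_t,y_t\}$, with symplectic product given by the commutator; $V_u=\bigoplus_{t\subset u}V_t$ (20-dimensional). A weight is identified (up to a constant factor) with the Lagrangian subspace $V_L\subset V_u$ of operators annihilating it. The delta function weight $\prod_{i=1}^5\delta(\ell_i)$ has $V_L$ spanned by the multiplication operators $\ell_1,\dots,\ell_5$ and all linear combinations of the $\partial/\partial x_t,\partial/\partial y_t$ annihilating $\ell_1,\dots,\ell_5$. For an edge $b$, $E_b\subset V_L$ is the space of edge operators: those $d\in V_L$ whose component in $V_t$ is zero for every $t\not\supset b$. The weight corresponds to $\omega$ if there are linearly independent $\mathsf e_b,\mathsf f_b\in E_b$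 for each edge $b$ (with $\mathsf e_{ij}=\mathsf e_{ji}$, $\mathsf f_{ij}=\mathsf f_{ji}$) and numbers $\gamma_{ij}\in\mathbb C^*$, $i\ne j$, such that for every vertex $i$ $$\sum_{j\ne i}\gamma_{ij}\mathsf e_{ij}=0,\qquad\sum_{j\ne i}\gamma_{ij}^{-1}\mathsf f_{ij}=0,$$ and for every oriented triangle $ijk$ $$\omega_{ijk}=\gamma_{ji}^{-1}\gamma_{jk}\gamma_{kj}^{-1}\gamma_{ki}\gamma_{ik}^{-1}\gamma_{ij}.$$ *)

theory Defs
  imports "HOL-Analysis.Analysis"
begin

(* The numeral type 5 has exactly the elements 1, 2, 3, 4, 5 (with 5 = 0). *)
type_synonym vertex = 5

typedef tetra = "{t :: vertex set. card t = 4}"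
  morphisms tetra_vertices Abs_tetra
proof -
  have "card (- {1 :: vertex}) = 4"
    by (simp add: Compl_eq_Diff_UNIV)
  then show ?thesis by blast
qed

instance tetra :: finite
proof
  have "(UNIV :: tetra set) = Abs_tetra ` {t. card t = 4}"
    by (rule set_eqI) (metis UNIV_I image_eqI tetra_vertices tetra_vertices_inverse)
  then show "finite (UNIV :: tetra set)"
    by (metis finite finite_imageI)
qed

(* The ten variables: (t, 1) stands for x_t and (t, 2) for y_t. *)
type_synonym bvar = "tetra \<times> 2"

(* The linear form sum_z (l $ z) z in the variables z. *)
type_synonym linform = "complex ^ bvar"

(* The space V_u, in coordinates: v $ Inl z is the coefficient of d/dz and v $ Inr z is the
   coefficient of multiplication by z. *)
type_synonym opr = "complex ^ (bvar + bvar)"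

definition mult_op :: "linform \<Rightarrow> opr" where
  "mult_op l = (\<chi> k. case k of Inl z \<Rightarrow> 0 | Inr z \<Rightarrow> l $ z)"

definition deriv_op :: "(bvar \<Rightarrow> complex) \<Rightarrow> opr" where
  "deriv_op a = (\<chi> k. case k of Inl z \<Rightarrow> a z | Inr z \<Rightarrow> 0)"

(* The commutator of two elements of V_u is a scalar; see op_act_commutator. *)
definition symp :: "opr \<Rightarrow> opr \<Rightarrow> complex" where
  "symp v w = (\<Sum>z\<in>UNIV. v $ Inl z * w $ Inr z - v $ Inr z * w $ Inl z)"


(* Justification of the coordinates: V_u acts faithfully on formal power series in the ten
   variables, given by their coefficient functions on exponents, and the commutator in this
   action is symp. *)

type_synonym fps10 = "(bvar \<Rightarrow> nat) \<Rightarrow> complex"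

definition var_act :: "bvar \<Rightarrow> fps10 \<Rightarrow> fps10" where
  "var_act z g = (\<lambda>m. if m z = 0 then 0 else g (m(z := m z - 1)))"

definition pd_act :: "bvar \<Rightarrow> fps10 \<Rightarrow> fps10" where
  "pd_act z g = (\<lambda>m. of_nat (Suc (m z)) * g (m(z := Suc (m z))))"

definition op_act :: "opr \<Rightarrow> fps10 \<Rightarrow> fps10" where
  "op_act v g = (\<lambda>m. \<Sum>z\<in>UNIV. v $ Inl z * pd_act z g m + v $ Inr z * var_act z g m)"

lemma var_var: "var_act z (var_act y g) = var_act y (var_act z g)"
  by (cases "y = z") (auto simp: var_act_def fun_eq_iff fun_upd_twist)

lemma pd_pd: "pd_act z (pd_act y g) = pd_act y (pd_act z g)"
  by (cases "y = z") (auto simp: pd_act_def fun_eq_iff fun_upd_twist)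

lemma pd_var: "pd_act z (var_act y g) m = var_act y (pd_act z g) m + (if y = z then g m else 0)"
proof (cases "y = z")
  case True
  then show ?thesis
    by (cases "m z") (auto simp: pd_act_def var_act_def algebra_simps fun_upd_idem)
next
  case False
  then show ?thesis
    by (auto simp: pd_act_def var_act_def fun_upd_twist)
qed

lemma pd_act_op_act:
  "pd_act y (op_act v g) m =
    (\<Sum>z\<in>UNIV. v $ Inl z * pd_act y (pd_act z g) m + v $ Inr z * pd_act y (var_act z g) m)"
  by (simp add: op_act_def pd_act_def sum_distrib_left algebra_simps)

lemma var_act_op_act:
  "var_act y (op_act v g) m =
    (\<Sum>z\<in>UNIV. v $ Inl z * var_act y (pd_act z g) m + v $ Inr z * var_act y (var_act z g) m)"
  by (simp add: op_act_def var_act_def)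

lemma op_act_op_act:
  "op_act v (op_act w g) m = (\<Sum>y\<in>UNIV. \<Sum>z\<in>UNIV.
     v $ Inl y * w $ Inl z * pd_act y (pd_act z g) m + v $ Inl y * w $ Inr z * pd_act y (var_act z g) m
   + v $ Inr y * w $ Inl z * var_act y (pd_act z g) m + v $ Inr y * w $ Inr z * var_act y (var_act z g) m)"
  by (subst op_act_def)
     (simp add: pd_act_op_act var_act_op_act sum_distrib_left sum.distrib algebra_simps)

lemma op_act_commutator:
  "op_act v (op_act w g) m - op_act w (op_act v g) m = symp v w * g m"
proof -
  have "op_act w (op_act v g) m = (\<Sum>z\<in>UNIV. \<Sum>y\<in>UNIV.
     w $ Inl y * v $ Inl z * pd_act y (pd_act z g) m + w $ Inl y * v $ Inr z * pd_act y (var_act z g) m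
   + w $ Inr y * v $ Inl z * var_act y (pd_act z g) m + w $ Inr y * v $ Inr z * var_act y (var_act z g) m)"
    unfolding op_act_op_act by (rule sum.swap)
  then have "op_act v (op_act w g) m - op_act w (op_act v g) m = (\<Sum>y\<in>UNIV. \<Sum>z\<in>UNIV.
      v $ Inl y * w $ Inr z * (if y = z then g m else 0)
      - v $ Inr y * w $ Inl z * (if y = z then g m else 0))"
    unfolding op_act_op_act
    apply (simp only: sum_subtractf [symmetric])
    apply (intro sum.cong refl)
    subgoal for y z
      using pd_pd [of y z g] var_var [of y z g]
      by (simp add: pd_var algebra_simps)
    done
  also have "\<dots> = symp v w * g m"
    by (simp add: symp_def sum_distrib_right sum_subtractf if_distrib [of "(*) _"] cong: if_cong)
       (simp add: sum_subtractf sum_distrib_right left_diff_distrib)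
  finally show ?thesis .
qed

lemma symp_zero_imp_zero:
  assumes "\<And>w. symp v w = 0"
  shows "v = 0"
proof -
  have "v $ k = 0" for k
  proof (cases k)
    case (Inl z)
    have "symp v (axis (Inr z) 1) = v $ Inl z"
      by (simp add: symp_def axis_def if_distrib [of "(*) _"] cong: if_cong)
    with assms Inl show ?thesis by simp
  next
    case (Inr z)
    have "symp v (axis (Inl z) 1) = - v $ Inr z"
      by (simp add: symp_def axis_def sum_negf if_distrib [of "(*) _"] cong: if_cong)
    with assms [of "axis (Inl z) 1"] Inr show ?thesis by simp
  qed
  then show ?thesis by (simp add: vec_eq_iff)
qed

lemma op_act_inject: "op_act v = op_act w \<longleftrightarrow> v = w"
proof
  assume eq: "op_act v = op_act w"
  have "symp (v - w) u = 0" for u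
  proof -
    have lin: "op_act (v - w) g = (\<lambda>m. op_act v g m - op_act w g m)" for g
      by (simp add: op_act_def sum_subtractf [symmetric] algebra_simps)
    have zero: "op_act (v - w) g = (\<lambda>m. 0)" for g
      by (simp add: lin eq)
    have "op_act u (\<lambda>m. 0) = (\<lambda>m. 0)"
      by (simp add: op_act_def pd_act_def var_act_def)
    with zero op_act_commutator [of "v - w" u "\<lambda>m. 1" undefined]
    show ?thesis by simp
  qed
  then show "v = w"
    using symp_zero_imp_zero [of "v - w"] by simp
qed simp


definition lagrangian :: "opr set \<Rightarrow> bool" where
  "lagrangian W \<longleftrightarrow> vec.subspace W \<and> W = {v. \<forall>w\<in>W. symp v w = 0}"

(* The derivation sum_z a_z d/dz takes the linear form l to the constant sum_z a_z l_z. *)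
definition annihilates :: "(bvar \<Rightarrow> complex) \<Rightarrow> linform \<Rightarrow> bool" where
  "annihilates a l \<longleftrightarrow> (\<Sum>z\<in>UNIV. a z * l $ z) = 0"

(* The subspace V_L of the weight delta(l 1) ... delta(l 5); the type 5 is here just an
   index set for the five forms. *)
definition delta_space :: "(5 \<Rightarrow> linform) \<Rightarrow> opr set" where
  "delta_space l = vec.span (range (\<lambda>i. mult_op (l i)) \<union> {deriv_op a |a. \<forall>i. annihilates a (l i)})"

definition edges :: "vertex set set" where
  "edges = {b. card b = 2}"

definition edge_ops :: "opr set \<Rightarrow> vertex set \<Rightarrow> opr set" where
  "edge_ops W b = {d \<in> W. \<forall>t. \<not> b \<subseteq> tetra_vertices t \<longrightarrow>
      (\<forall>s. d $ Inl (t, s) = 0 \<and> d $ Inr (t, s) = 0)}"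

(* \<omega> i j k is the value on the triangle ijk oriented by the order of its vertices, hence the
   invariance under cyclic shifts. Values at non-distinct arguments are irrelevant. *)
definition mult_cocycle :: "(vertex \<Rightarrow> vertex \<Rightarrow> vertex \<Rightarrow> complex) \<Rightarrow> bool" where
  "mult_cocycle \<omega> \<longleftrightarrow>
     (\<forall>i j k. distinct [i, j, k] \<longrightarrow>
        \<omega> i j k \<noteq> 0 \<and> \<omega> j k i = \<omega> i j k \<and> \<omega> j i k = inverse (\<omega> i j k)) \<and>
     (\<forall>i j k l. distinct [i, j, k, l] \<longrightarrow> \<omega> i j k * \<omega> i k l = \<omega> i j l * \<omega> j k l)"

definition corresponds :: "(vertex \<Rightarrow> vertex \<Rightarrow> vertex \<Rightarrow> complex) \<Rightarrow> opr set \<Rightarrow> bool" where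
  "corresponds \<omega> W \<longleftrightarrow>
     (\<exists>(e :: vertex set \<Rightarrow> opr) (f :: vertex set \<Rightarrow> opr) (\<gamma> :: vertex \<Rightarrow> vertex \<Rightarrow> complex).
        (\<forall>b\<in>edges. e b \<in> edge_ops W b \<and> f b \<in> edge_ops W b \<and>
           e b \<noteq> f b \<and> vec.independent {e b, f b}) \<and>
        (\<forall>i j. i \<noteq> j \<longrightarrow> \<gamma> i j \<noteq> 0) \<and>
        (\<forall>i. (\<Sum>j\<in>UNIV - {i}. \<gamma> i j *s e {i, j}) = 0) \<and>
        (\<forall>i. (\<Sum>j\<in>UNIV - {i}. inverse (\<gamma> i j) *s f {i, j}) = 0) \<and>
        (\<forall>i j k. distinct [i, j, k] \<longrightarrow>
           \<omega> i j k = inverse (\<gamma> j i) * \<gamma> j k * inverse (\<gamma> k j) * \<gamma> k i * inverse (\<gamma> i k) * \<gamma> i j))"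

end

theory Submission
  imports Defs
begin

subsection \<open>The pairing of edge operators in a tetrahedron\<close>

text \<open>Look for the \<open>e\<^sub>b\<close> among the multiplication operators and the \<open>f\<^sub>b\<close> among the derivations. Within a
  tetrahedron \<open>t\<close> the vertex relations leave, since \<open>\<omega> \<noteq> -1\<close>, a two-dimensional space of possible
  \<open>t\<close>-components, so the components of all \<open>e\<^sub>b\<close> and \<open>f\<^sub>b\<close> in \<open>V\<^sub>t\<close> are encoded, by a rank two factorization,
  in the bilinear form \<open>\<langle>e\<^sub>b, f\<^sub>b\<^sub>'\<rangle>\<^sub>t\<close>. There is an explicit such form which is a signed sum over the faces
  of \<open>t\<close> of terms depending only on the face. As each triangle lies in two tetrahedra with opposite signs,
  the forms of the five tetrahedra sum to zero; that is, every \<open>f\<^sub>b\<close> annihilates every \<open>e\<^sub>b\<^sub>'\<close>. Five of the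
  \<open>e\<^sub>b\<close> are a basis of their span and serve as the linear forms.\<close>

section \<open>Orientation signs of the faces of a tetrahedron\<close>

lemma complement_singleton:
  fixes m i j k :: vertex
  assumes "distinct [m, i, j, k]"
  obtains l where "UNIV = {m, i, j, k, l}" and "distinct [m, i, j, k, l]"
proof -
  have "card {m, i, j, k} = 4" using assms by simp
  then have "card (- {m, i, j, k}) = 1"
    by (simp add: Compl_eq_Diff_UNIV card_Diff_subset)
  then obtain l where "- {m, i, j, k} = {l}"
    by (meson card_1_singletonE)
  then show ?thesis
    using that[of l] assms by auto
qed

text \<open>Stands in for the sign of a permutation of the vertices: it is alternating, and nonzero
  exactly on distinct arguments, which suffices because the pairing matters only up to a factor. The
  numbering \<open>to_nat\<close> merely supplies distinct values.\<close>

definition vandermonde :: "vertex \<Rightarrow> vertex \<Rightarrow> vertex \<Rightarrow> vertex \<Rightarrow> vertex \<Rightarrow> complex" where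
  "vandermonde a b c d p = (let r = (\<lambda>v. of_nat (to_nat v)) in
     (r b - r a) * (r c - r a) * (r d - r a) * (r p - r a) * (r c - r b) * (r d - r b) *
     (r p - r b) * (r d - r c) * (r p - r c) * (r p - r d))"

lemma vandermonde_swap:
  "vandermonde b a c d p = - vandermonde a b c d p"
  "vandermonde a c b d p = - vandermonde a b c d p"
  "vandermonde a b d c p = - vandermonde a b c d p"
  "vandermonde a b c p d = - vandermonde a b c d p"
proof -
  have *: "u - v = - (v - u)" for u v :: complex by simp
  let ?r = "\<lambda>v. of_nat (to_nat v) :: complex"
  show "vandermonde b a c d p = - vandermonde a b c d p"
    unfolding vandermonde_def Let_def by (subst *[of "?r a" "?r b"]) (simp only: mult_minus_left mult_minus_right mult_ac)
  show "vandermonde a c b d p = - vandermonde a b c d p"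
    unfolding vandermonde_def Let_def by (subst *[of "?r b" "?r c"]) (simp only: mult_minus_left mult_minus_right mult_ac)
  show "vandermonde a b d c p = - vandermonde a b c d p"
    unfolding vandermonde_def Let_def by (subst *[of "?r c" "?r d"]) (simp only: mult_minus_left mult_minus_right mult_ac)
  show "vandermonde a b c p d = - vandermonde a b c d p"
    unfolding vandermonde_def Let_def by (subst *[of "?r d" "?r p"]) (simp only: mult_minus_left mult_minus_right mult_ac)
qed

lemma vandermonde_eq_0_iff: "vandermonde a b c d p = 0 \<longleftrightarrow> \<not> distinct [a, b, c, d, p]"
  by (auto simp: vandermonde_def)

text \<open>Up to a constant factor, \<open>face_sign m x y z\<close> is the sign with which the oriented triangle
  \<open>xyz\<close> enters the boundary of the tetrahedron opposite to \<open>m\<close>.\<close>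

definition face_sign :: "vertex \<Rightarrow> vertex \<Rightarrow> vertex \<Rightarrow> vertex \<Rightarrow> complex" where
  "face_sign m x y z = (\<Sum>p\<in>UNIV. vandermonde m x y z p)"

lemma face_sign_swap:
  "face_sign x m y z = - face_sign m x y z"
  "face_sign m y x z = - face_sign m x y z"
  "face_sign m x z y = - face_sign m x y z"
  unfolding face_sign_def sum_negf[symmetric]
  by (rule sum.cong[OF refl], rule vandermonde_swap)+

text \<open>Exchanging \<open>z\<close> with the hidden vertex \<open>p\<close> turns the double sum
  into its negative. Geometrically, the two faces of a tetrahedron at a common edge carry opposite
  signs.\<close>

lemma face_sign_sum: "(\<Sum>z\<in>UNIV. face_sign m x y z) = 0"
proof -
  have "(\<Sum>z\<in>UNIV. face_sign m x y z) = (\<Sum>z\<in>UNIV. \<Sum>p\<in>UNIV. vandermonde m x y p z)"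
    unfolding face_sign_def by (rule sum.swap)
  also have "\<dots> = - (\<Sum>z\<in>UNIV. face_sign m x y z)"
    unfolding face_sign_def by (subst vandermonde_swap(4)) (simp only: sum_negf)
  finally show ?thesis by simp
qed

lemma face_sign_sum': "(\<Sum>z\<in>UNIV. face_sign m x z y) = 0"
proof -
  have "(\<Sum>z\<in>UNIV. face_sign m x z y) = (\<Sum>z\<in>UNIV. - face_sign m x y z)"
    by (rule sum.cong[OF refl]) (rule face_sign_swap)
  then show ?thesis by (simp add: sum_negf face_sign_sum)
qed

text \<open>Three transpositions move \<open>m\<close> to the last place, where
  \<open>face_sign_sum\<close> applies.\<close>

lemma face_sign_sum_opposite: "(\<Sum>m\<in>UNIV. face_sign m x y z) = 0"
proof -
  have "face_sign m x y z = - face_sign x y z m" for m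
    by (metis face_sign_swap)
  then show ?thesis
    using face_sign_sum[of x y z] by (simp add: sum_negf)
qed

lemma face_sign_eq_0_iff: "face_sign m x y z = 0 \<longleftrightarrow> \<not> distinct [m, x, y, z]"
proof (cases "distinct [m, x, y, z]")
  case True
  then obtain p where UN: "UNIV = {m, x, y, z, p}" and p: "distinct [m, x, y, z, p]"
    by (rule complement_singleton)
  have "face_sign m x y z = (\<Sum>q\<in>{p}. vandermonde m x y z q)"
    unfolding face_sign_def
    by (rule sum.mono_neutral_right) (use UN in \<open>auto simp: vandermonde_eq_0_iff\<close>)
  with p True show ?thesis by (simp add: vandermonde_eq_0_iff)
next
  case False
  then have "face_sign m x y z = 0"
    unfolding face_sign_def by (intro sum.neutral) (auto simp: vandermonde_eq_0_iff)
  then show ?thesis using False by simp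
qed

text \<open>Edge operators are indexed by oriented edges, with \<open>e\<^sub>j\<^sub>i = c\<^sub>j\<^sub>i e\<^sub>i\<^sub>j\<close> and \<open>f\<^sub>j\<^sub>i = c\<^sub>i\<^sub>j f\<^sub>i\<^sub>j\<close>, where
  \<open>c\<^sub>i\<^sub>j = \<gamma>\<^sub>i\<^sub>j / \<gamma>\<^sub>j\<^sub>i\<close>; these are \<open>\<gamma>\<^sub>i\<^sub>j e\<^sub>b\<close> and \<open>\<gamma>\<^sub>i\<^sub>j\<inverse> f\<^sub>b\<close> in the paper's notation. Then \<open>coord c i j x y\<close> is the
  coordinate of \<open>e\<^sub>i\<^sub>j\<close> with respect to \<open>e\<^sub>x\<^sub>y\<close>, and for \<open>f\<close> the transposed \<open>c\<close> takes the place of \<open>c\<close>.\<close>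

definition coord :: "(vertex \<Rightarrow> vertex \<Rightarrow> complex) \<Rightarrow> vertex \<Rightarrow> vertex \<Rightarrow> vertex \<Rightarrow> vertex \<Rightarrow> complex" where
  "coord c i j x y = (if x = i \<and> y = j then 1 else 0) + (if x = j \<and> y = i then c i j else 0)"

text \<open>With \<open>c i j = \<gamma> i j / \<gamma> j i\<close> this is the product by which
  \<open>corresponds\<close> expresses \<open>\<omega>\<close>.\<close>

definition holonomy :: "(vertex \<Rightarrow> vertex \<Rightarrow> complex) \<Rightarrow> vertex \<Rightarrow> vertex \<Rightarrow> vertex \<Rightarrow> complex" where
  "holonomy c x y z = c x y * c y z * c z x"

text \<open>The intended pairing, in the tetrahedron opposite to \<open>m\<close>, of the \<open>e\<close>- with the \<open>f\<close>-operators. It is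
  forced up to a factor: opposite edges must be orthogonal, and the vertex relations then give
  \<open>\<plusminus> \<omega> / (1 + \<omega>)\<close> for two edges of a triangle, independently of the tetrahedron containing it, and
  determine the pairing of an edge with itself (the term \<open>v x y\<close>).\<close>

definition edge_form :: "(vertex \<Rightarrow> vertex \<Rightarrow> complex) \<Rightarrow> vertex \<Rightarrow> (vertex \<Rightarrow> vertex \<Rightarrow> complex) \<Rightarrow>
    (vertex \<Rightarrow> vertex \<Rightarrow> complex) \<Rightarrow> complex" where
  "edge_form c m u v = (\<Sum>x\<in>UNIV. \<Sum>y\<in>UNIV. \<Sum>z\<in>UNIV.
     face_sign m x y z / (1 + holonomy c x y z) * u x y * (2 * holonomy c x y z * v x z + v x y))"

definition pairing :: "(vertex \<Rightarrow> vertex \<Rightarrow> complex) \<Rightarrow> vertex \<Rightarrow>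
    vertex \<Rightarrow> vertex \<Rightarrow> vertex \<Rightarrow> vertex \<Rightarrow> complex" where
  "pairing c m i j k l = edge_form c m (coord c i j) (coord (\<lambda>x y. c y x) k l)"

section \<open>Symmetries and kernel of the pairing form\<close>

lemma edge_form_sum_opposite: "(\<Sum>m\<in>UNIV. edge_form c m u v) = 0"
proof -
  have "(\<Sum>m\<in>UNIV. edge_form c m u v) = (\<Sum>x\<in>UNIV. \<Sum>y\<in>UNIV. \<Sum>z\<in>UNIV. \<Sum>m\<in>UNIV.
     face_sign m x y z / (1 + holonomy c x y z) * u x y * (2 * holonomy c x y z * v x z + v x y))"
    unfolding edge_form_def
    by (rule trans[OF sum.swap], rule sum.cong[OF refl],
        rule trans[OF sum.swap], rule sum.cong[OF refl], rule sum.swap)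
  also have "\<dots> = 0"
    by (simp add: sum_distrib_right[symmetric] sum_divide_distrib[symmetric] face_sign_sum_opposite)
  finally show ?thesis .
qed

lemma edge_form_sum_left: "edge_form c m (\<lambda>x y. \<Sum>j\<in>A. u j x y) v = (\<Sum>j\<in>A. edge_form c m (u j) v)"
  by (induction A rule: infinite_finite_induct)
    (simp_all add: edge_form_def sum.distrib algebra_simps add_divide_distrib)

text \<open>The normalised diagonal gives degenerate triangles holonomy 1. Hence the denominators
  \<open>1 + holonomy c x y z\<close> never vanish, and sums can run over all vertices without
  distinctness conditions.\<close>

locale edge_weight =
  fixes c :: "vertex \<Rightarrow> vertex \<Rightarrow> complex"
  assumes c_refl [simp]: "c x x = 1"
    and c_inverse: "c x y * c y x = 1"
    and holonomy_neq: "holonomy c x y z \<noteq> -1"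
begin

lemma c_nonzero [simp]: "c x y \<noteq> 0"
  using c_inverse[of x y] by auto

lemma holonomy_nonzero [simp]: "holonomy c x y z \<noteq> 0"
  by (simp add: holonomy_def)

lemma holonomy_swap: "holonomy c y x z = 1 / holonomy c x y z" "holonomy c x z y = 1 / holonomy c x y z"
proof -
  have "holonomy c y x z * holonomy c x y z = (c x y * c y x) * (c y z * c z y) * (c z x * c x z)"
    by (simp add: holonomy_def)
  then show "holonomy c y x z = 1 / holonomy c x y z" by (simp add: c_inverse field_simps)
  have "holonomy c x z y * holonomy c x y z = (c x y * c y x) * (c y z * c z y) * (c z x * c x z)"
    by (simp add: holonomy_def)
  then show "holonomy c x z y = 1 / holonomy c x y z" by (simp add: c_inverse field_simps)
qed

lemma one_plus_holonomy [simp]: "1 + holonomy c x y z \<noteq> 0"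
  using holonomy_neq[of x y z] by (metis minus_unique)

lemma holonomy_transpose: "holonomy (\<lambda>x y. c y x) x y z = 1 / holonomy c x y z"
  using holonomy_swap(2)[of x y z] by (simp add: holonomy_def mult.commute mult.left_commute)

lemma edge_weight_transpose: "edge_weight (\<lambda>x y. c y x)"
proof
  show "holonomy (\<lambda>x y. c y x) x y z \<noteq> -1" for x y z
    using holonomy_neq[of x z y] by (simp add: holonomy_def mult_ac)
qed (simp_all add: c_inverse)

text \<open>Makes the two arguments interchangeable, so that facts about the \<open>e\<close> side
  transfer to the \<open>f\<close> side with the transposed weight.\<close>

lemma edge_form_transpose: "edge_form c m u v = - edge_form (\<lambda>x y. c y x) m v u"
proof -
  let ?w = "holonomy c" and ?s = "face_sign m"
  \<comment> \<open>This vanishing sum is subtracted from the terms with \<open>v x y\<close>. As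
    1/(1+w) - 1 = -1/(1+1/w), that produces the coefficient belonging to the transposed
    weight.\<close>
  have 1: "(\<Sum>z\<in>UNIV. ?s x y z * (u x y * v x y)) = 0" for x y
    by (simp add: sum_distrib_right[symmetric] face_sign_sum)
  have "edge_form c m u v = (\<Sum>x\<in>UNIV. \<Sum>y\<in>UNIV. \<Sum>z\<in>UNIV. ?s x y z / (1 + ?w x y z) * u x y * (2 * ?w x y z * v x z))
     + (\<Sum>x\<in>UNIV. \<Sum>y\<in>UNIV. \<Sum>z\<in>UNIV. ?s x y z / (1 + ?w x y z) * u x y * v x y)"
    by (simp add: edge_form_def distrib_left sum.distrib)
  also have "(\<Sum>x\<in>UNIV. \<Sum>y\<in>UNIV. \<Sum>z\<in>UNIV. ?s x y z / (1 + ?w x y z) * u x y * (2 * ?w x y z * v x z)) =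
     (\<Sum>x\<in>UNIV. \<Sum>y\<in>UNIV. \<Sum>z\<in>UNIV. ?s x z y / (1 + ?w x z y) * u x z * (2 * ?w x z y * v x y))"
    by (rule sum.cong[OF refl], rule sum.swap)
  also have "(\<Sum>x\<in>UNIV. \<Sum>y\<in>UNIV. \<Sum>z\<in>UNIV. ?s x y z / (1 + ?w x y z) * u x y * v x y) =
    (\<Sum>x\<in>UNIV. \<Sum>y\<in>UNIV. \<Sum>z\<in>UNIV. ?s x y z / (1 + ?w x y z) * u x y * v x y - ?s x y z * (u x y * v x y))"
    by (simp only: sum_subtractf 1 diff_zero)
  finally show ?thesis
    unfolding edge_form_def sum.distrib[symmetric] sum_negf[symmetric]
  proof (elim trans, intro sum.cong refl)
    fix x y z
    show "?s x z y / (1 + ?w x z y) * u x z * (2 * ?w x z y * v x y) +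
       (?s x y z / (1 + ?w x y z) * u x y * v x y - ?s x y z * (u x y * v x y)) =
       - (?s x y z / (1 + holonomy (\<lambda>x y. c y x) x y z) * v x y *
          (2 * holonomy (\<lambda>x y. c y x) x y z * u x z + u x y))"
      unfolding holonomy_transpose holonomy_swap(2)[of x y z] face_sign_swap(3)[of m x z y]
      using one_plus_holonomy[of x y z] holonomy_nonzero[of x y z]
      by (simp add: divide_simps add.commute) (simp add: algebra_simps)
  qed
qed

text \<open>The first argument is the sum of \<open>coord c i j\<close> over \<open>j\<close>, so
  this is the relation at vertex \<open>i\<close>. In the sum of a term and the one with
  \<open>y\<close> and \<open>z\<close> exchanged the holonomy cancels; what remains are face signs
  times values of \<open>v\<close> at \<open>i\<close>, and these signs sum to zero.\<close>

lemma edge_form_kernel: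
  assumes v: "\<And>x y. v y x = c y x * v x y"
  shows "edge_form c m (\<lambda>x y. (if x = i then 1 else 0) + (if y = i then c i x else 0)) v = 0"
proof -
  let ?w = "holonomy c" and ?s = "face_sign m"
  \<comment> \<open>\<open>?T y z\<close> collects the contributions of the oriented edges
    \<open>i y\<close> and \<open>y i\<close> with third vertex \<open>z\<close>.\<close>
  let ?T = "\<lambda>y z. ?s i y z / (1 + ?w i y z) * (2 * ?w i y z * v i z + v i y) +
     ?s y i z / (1 + ?w y i z) * c i y * (2 * ?w y i z * v y z + v y i)"
  have T: "?T y z + ?T z y = ?s i y z * v i z + ?s i z y * v i y" for y z
  proof -
    have a: "c i y * v y i = v i y" for y
      by (rule v[symmetric])
    \<comment> \<open>Going round the triangle relates the two values of \<open>v\<close> on the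
      edge opposite to \<open>i\<close> through the holonomy.\<close>
    have b: "holonomy c i y z * (c i z * v z y) = c i y * v y z"
    proof -
      have "holonomy c i y z * (c i z * v z y) = c i y * (c z i * c i z) * (c y z * v z y)"
        by (simp add: holonomy_def)
      then show ?thesis by (simp add: c_inverse v[of y z])
    qed
    define W p q where "W = holonomy c i y z" and "p = c i y * v y z" and "q = c i z * v z y"
    have W: "W \<noteq> 0" "1 + W \<noteq> 0" and q: "p = W * q"
      unfolding W_def p_def q_def using b by simp_all
    have T1: "?T y z = ?s i y z / (1 + W) * (2 * W * v i z + v i y)
        - ?s i y z / (1 + 1 / W) * (2 / W * p + v i y)"
      unfolding holonomy_swap(1)[of i y z] face_sign_swap(2)[of m y i z] W_def p_def a[of y, symmetric]
      by (simp add: algebra_simps add_divide_distrib)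
    have T2: "?T z y = - ?s i y z / (1 + 1 / W) * (2 / W * v i y + v i z)
        + ?s i y z / (1 + W) * (2 * W * q + v i z)"
      unfolding holonomy_swap(1)[of z i y] holonomy_swap(2)[of i z y] face_sign_swap(2)[of m z i y] face_sign_swap(3)[of m i z y] W_def q_def a[of z, symmetric]
      by (simp add: algebra_simps add_divide_distrib)
    have "1 / (1 + 1 / W) = W / (1 + W)" using W by (simp add: field_simps)
    then show ?thesis
      apply (subst T1, subst T2)
      unfolding face_sign_swap(3)[of m i z y] q using W
      by (simp add: divide_simps add.commute) (simp add: algebra_simps)
  qed
  have "edge_form c m (\<lambda>x y. (if x = i then 1 else 0) + (if y = i then c i x else 0)) v =
    (\<Sum>x\<in>UNIV. \<Sum>y\<in>UNIV. if x = i then (\<Sum>z\<in>UNIV. ?s x y z / (1 + ?w x y z) * (2 * ?w x y z * v x z + v x y)) else 0) +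
    (\<Sum>x\<in>UNIV. \<Sum>y\<in>UNIV. if y = i then (\<Sum>z\<in>UNIV. ?s x y z / (1 + ?w x y z) * c i x * (2 * ?w x y z * v x z + v x y)) else 0)"
    unfolding edge_form_def sum.distrib[symmetric]
    by (intro sum.cong refl) (auto simp: sum.distrib[symmetric] algebra_simps add_divide_distrib)
  also have "\<dots> = (\<Sum>y\<in>UNIV. \<Sum>z\<in>UNIV. ?T y z)"
    by (subst sum.swap) (simp add: sum.distrib)
  finally have A: "edge_form c m (\<lambda>x y. (if x = i then 1 else 0) + (if y = i then c i x else 0)) v = (\<Sum>y\<in>UNIV. \<Sum>z\<in>UNIV. ?T y z)" .
  define S where "S y z = ?T y z" for y z
  have "2 * (\<Sum>y\<in>UNIV. \<Sum>z\<in>UNIV. S y z) =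
      (\<Sum>y\<in>UNIV. \<Sum>z\<in>UNIV. S y z) + (\<Sum>y\<in>UNIV. \<Sum>z\<in>UNIV. S z y)"
    by (subst (3) sum.swap) (rule mult_2)
  also have "\<dots> = (\<Sum>y\<in>UNIV. \<Sum>z\<in>UNIV. S y z + S z y)"
    by (simp only: sum.distrib)
  also have "\<dots> = (\<Sum>y\<in>UNIV. \<Sum>z\<in>UNIV. ?s i y z * v i z + ?s i z y * v i y)"
    unfolding S_def by (simp only: T)
  also have "\<dots> = (\<Sum>z\<in>UNIV. \<Sum>y\<in>UNIV. ?s i y z * v i z) + (\<Sum>y\<in>UNIV. \<Sum>z\<in>UNIV. ?s i z y * v i y)"
    unfolding sum.distrib by (rule arg_cong2[where f = "(+)", OF sum.swap refl])
  also have "\<dots> = 0"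
    unfolding sum_distrib_right[symmetric] face_sign_sum' by simp
  finally have "(\<Sum>y\<in>UNIV. \<Sum>z\<in>UNIV. S y z) = 0" by simp
  then have "(\<Sum>y\<in>UNIV. \<Sum>z\<in>UNIV. ?T y z) = 0" by (simp only: S_def)
  then show ?thesis by (rule trans[OF A])
qed

lemma edge_form_coord:
  "edge_form c m (coord c i j) v =
    (\<Sum>z\<in>UNIV. face_sign m i j z / (1 + holonomy c i j z) * (2 * holonomy c i j z * v i z + v i j)) +
    c i j * (\<Sum>z\<in>UNIV. face_sign m j i z / (1 + holonomy c j i z) * (2 * holonomy c j i z * v j z + v j i))"
proof -
  let ?g = "\<lambda>x y. \<Sum>z\<in>UNIV. face_sign m x y z / (1 + holonomy c x y z) * (2 * holonomy c x y z * v x z + v x y)"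
  have "edge_form c m (coord c i j) v = (\<Sum>x\<in>UNIV. \<Sum>y\<in>UNIV. coord c i j x y * ?g x y)"
    unfolding edge_form_def sum_distrib_left by (intro sum.cong refl) (simp add: mult_ac)
  also have "\<dots> = (\<Sum>x\<in>UNIV. \<Sum>y\<in>UNIV. if y = j then (if x = i then ?g x y else 0) else 0) +
      (\<Sum>x\<in>UNIV. \<Sum>y\<in>UNIV. if y = i then (if x = j then c i j * ?g x y else 0) else 0)"
    unfolding sum.distrib[symmetric]
    by (intro sum.cong refl) (simp add: coord_def algebra_simps)
  also have "\<dots> = ?g i j + c i j * ?g j i" by simp
  finally show ?thesis .
qed

lemma coord_homogeneous: "coord c i j y x = c x y * coord c i j x y"
  using c_inverse[of x y] c_inverse[of i j] by (cases "x = i"; cases "y = j"; cases "x = j"; cases "y = i"; simp add: coord_def algebra_simps)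

lemma coord_swap: "coord c j i x y = c j i * coord c i j x y"
  using c_inverse[of x y] c_inverse[of i j] by (cases "x = i"; cases "y = j"; cases "x = j"; cases "y = i"; simp add: coord_def algebra_simps)

lemma pairing_transpose: "pairing c m i j k l = - pairing (\<lambda>x y. c y x) m k l i j"
  unfolding pairing_def by (rule edge_form_transpose)

text \<open>Describes one coordinate of the whole family of operators \<open>e\<close> in the
  tetrahedron opposite to \<open>m\<close>. The diagonal is set to 0 so that the vertex relations
  can be sums over all vertices.\<close>

definition edge_cochain :: "vertex \<Rightarrow> (vertex \<Rightarrow> vertex \<Rightarrow> complex) \<Rightarrow> bool" where
  "edge_cochain m u \<longleftrightarrow> (\<forall>x y. u y x = c y x * u x y) \<and> (\<forall>x. (\<Sum>y\<in>UNIV. u x y) = 0) \<and>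
     (\<forall>x. u m x = 0) \<and> (\<forall>x. u x x = 0)"

lemma edge_cochainD:
  assumes "edge_cochain m u"
  shows "u y x = c y x * u x y" and "(\<Sum>y\<in>UNIV. u x y) = 0" and "u m x = 0" and "u x x = 0"
proof -
  note D = assms[unfolded edge_cochain_def]
  show "u y x = c y x * u x y" by (rule D[THEN conjunct1, rule_format])
  show "(\<Sum>y\<in>UNIV. u x y) = 0" by (rule D[THEN conjunct2, THEN conjunct1, rule_format])
  show "u m x = 0" by (rule D[THEN conjunct2, THEN conjunct2, THEN conjunct1, rule_format])
  show "u x x = 0" by (rule D[THEN conjunct2, THEN conjunct2, THEN conjunct2, rule_format])
qed

lemma edge_cochainI:
  assumes "\<And>x y. u y x = c y x * u x y" and "\<And>x. (\<Sum>y\<in>UNIV. u x y) = 0"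
    and "\<And>x. u m x = 0" and "\<And>x. u x x = 0"
  shows "edge_cochain m u"
  unfolding edge_cochain_def by (intro conjI allI assms)

lemma edge_cochain_scale:
  assumes "edge_cochain m u"
  shows "edge_cochain m (\<lambda>x y. u x y * a)"
proof (rule edge_cochainI)
  note D = edge_cochainD[OF assms]
  show "u y x * a = c y x * (u x y * a)" for x y
    by (subst D(1)) (rule mult.assoc)
qed (simp_all add: sum_distrib_right[symmetric] edge_cochainD(2-4)[OF assms])

lemma edge_cochain_diff:
  assumes "edge_cochain m u" and "edge_cochain m v"
  shows "edge_cochain m (\<lambda>x y. u x y - v x y)"
proof (rule edge_cochainI)
  show "u y x - v y x = c y x * (u x y - v x y)" for x y
    unfolding right_diff_distrib
    by (rule arg_cong2[where f = "(-)"]; rule edge_cochainD(1); fact)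
qed (simp_all add: sum_subtractf edge_cochainD(2-4)[OF assms(1)] edge_cochainD(2-4)[OF assms(2)])

text \<open>Here \<open>\<omega> \<noteq> -1\<close> enters: the relations at the vertices \<open>j, k, l\<close> of the remaining triangle have
  determinant proportional to \<open>1 + \<omega>\<^sub>j\<^sub>k\<^sub>l\<close>.\<close>

lemma edge_cochain_eq_0:
  assumes u: "edge_cochain m u" and dist: "distinct [m, i, j, k]"
    and ij: "u i j = 0" and ik: "u i k = 0"
  shows "u x y = 0"
proof -
  note swap = edge_cochainD(1)[OF u] and sum0 = edge_cochainD(2)[OF u]
    and m0 = edge_cochainD(3)[OF u] and d0 = edge_cochainD(4)[OF u]
  have rev: "u y x = 0" if "u x y = 0" for x y
    unfolding swap[of y x] that by (rule mult_zero_right)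
  have m1: "u x m = 0" for x by (rule rev) (rule m0)
  obtain l where l: "UNIV = {m, i, j, k, l}" "distinct [m, i, j, k, l]"
    using complement_singleton[OF dist] .
  have expand: "u x m + u x i + u x j + u x k + u x l = 0" for x
    using sum0[of x] unfolding l(1) using l(2) by (simp add: add_ac)
  note ji = rev[OF ij] and ki = rev[OF ik]
  have il: "u i l = 0" using expand[of i] ij ik m1 d0 by simp
  note li = rev[OF il]
  have jl: "u j l = - u j k" using expand[of j] ji m1 d0 by (simp add: add_eq_0_iff)
  have kl: "u k l = - u k j" using expand[of k] ki m1 d0 by (simp add: add_eq_0_iff)
  have "0 = u l j + u l k" using expand[of l] li m1 d0 by simp
  also have "\<dots> = c l j * u j l + c l k * u k l" by (simp only: swap[where x = j and y = l] swap[where x = k and y = l])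
  also have "\<dots> = - ((c l j + c l k * c k j) * u j k)"
    unfolding jl kl swap[where x = j and y = k] by (simp add: algebra_simps)
  finally have "(c l j + c l k * c k j) * u j k = 0" by (metis neg_0_equal_iff_equal)
  moreover have "c l j * (1 + holonomy c l k j) = c l j + c l k * c k j"
    using c_inverse[of l j] by (simp add: holonomy_def algebra_simps)
  then have "c l j + c l k * c k j \<noteq> 0"
    by (metis c_nonzero mult_eq_0_iff one_plus_holonomy)
  ultimately have jk: "u j k = 0" by simp
  have kj: "u k j = 0" by (rule rev[OF jk])
  have jl: "u j l = 0" and kl: "u k l = 0" using jk kj jl kl by simp_all
  note zeros = jk kj jl kl rev[OF jl] rev[OF kl]
  moreover have "x \<in> {m, i, j, k, l}" "y \<in> {m, i, j, k, l}" by (simp_all flip: l(1))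
  ultimately show ?thesis
    using m0 m1 d0 ij ik il ji ki li jk by auto
qed

text \<open>The vertex relations come from \<open>edge_form_kernel\<close>; on edges through
  \<open>m\<close> every face sign vanishes.\<close>

lemma edge_cochain_pairing: "edge_cochain m (\<lambda>x y. pairing c m x y k l)"
proof (rule edge_cochainI)
  interpret t: edge_weight "\<lambda>x y. c y x" by (rule edge_weight_transpose)
  let ?v = "coord (\<lambda>x y. c y x) k l"
  have zero: "pairing c m x y k l = 0" if "m = x \<or> x = y" for x y
    unfolding pairing_def edge_form_coord using that by (auto simp: face_sign_eq_0_iff[THEN iffD2] intro!: sum.neutral)
  show "pairing c m x x k l = 0" "pairing c m m x k l = 0" for x
    by (rule zero, simp)+
  show "pairing c m y x k l = c y x * pairing c m x y k l" for x y
  proof -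
    have "pairing c m y x k l = edge_form c m (\<lambda>a b. c y x * coord c x y a b) ?v"
      unfolding pairing_def
      by (rule arg_cong[where f = "\<lambda>u. edge_form c m u ?v"]) (intro ext, rule coord_swap)
    also have "\<dots> = c y x * pairing c m x y k l"
      unfolding edge_form_def pairing_def sum_distrib_left by (intro sum.cong refl) (simp add: mult_ac)
    finally show ?thesis .
  qed
  show "(\<Sum>y\<in>UNIV. pairing c m x y k l) = 0" for x
  proof -
    have *: "(\<Sum>j\<in>UNIV. coord c x j a b) = (if a = x then 1 else 0) + (if b = x then c x a else 0)" for a b
      by (cases "a = x"; cases "b = x"; simp add: coord_def sum.distrib)
    show ?thesis
      unfolding pairing_def edge_form_sum_left[symmetric] *
      by (rule edge_form_kernel) (rule t.coord_homogeneous)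
  qed
qed

section \<open>Values and rank of the pairing\<close>

lemma pairing_swap:
  "pairing c m y x k l = c y x * pairing c m x y k l"
  by (rule edge_cochainD(1)[OF edge_cochain_pairing])

text \<open>Every term of the form combines two edges that share the vertex
  \<open>x\<close>.\<close>

lemma pairing_disjoint: "distinct [i, j, k, l] \<Longrightarrow> pairing c m i j k l = 0"
  unfolding pairing_def edge_form_coord by (auto simp: coord_def intro!: sum.neutral)

lemma pairing_adjacent:
  assumes "distinct [m, k, i, l]"
  shows "pairing c m k i k l = 2 * face_sign m k i l * holonomy c k i l / (1 + holonomy c k i l)"
  unfolding pairing_def edge_form_coord using assms
  by (auto simp: coord_def if_distrib[of "(*) _"] cong: if_cong)

text \<open>These entries are the pivots of the factorization, and later they certify that operators
  are nonzero and forms independent.\<close>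

lemma pairing_adjacent_nonzero:
  assumes "distinct [m, k, i, l]"
  shows "pairing c m k i k l \<noteq> 0" "pairing c m i k k l \<noteq> 0"
  using assms by (auto simp: pairing_swap[of m i k] pairing_adjacent face_sign_eq_0_iff)

text \<open>By \<open>edge_cochain_eq_0\<close> a cochain is determined by its values on two edges
  at \<open>i\<close>, so the pairing has rank at most two. The two summands will become the two
  variables of a tetrahedron.\<close>

lemma pairing_factorization:
  "\<exists>E F :: 2 \<Rightarrow> vertex \<Rightarrow> vertex \<Rightarrow> complex.
    (\<forall>s. edge_cochain m (E s) \<and> edge_weight.edge_cochain (\<lambda>x y. c y x) m (F s)) \<and>
    (\<forall>x y x' y'. pairing c m x y x' y' = (\<Sum>s\<in>UNIV. E s x y * F s x' y'))"
proof -
  interpret t: edge_weight "\<lambda>x y. c y x" by (rule edge_weight_transpose)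
  define i j k l where "i = m + 1" and "j = m + 2" and "k = m + 3" and "l = m + 4"
  have d: "distinct [m, i, j, k, l]" by (simp add: i_def j_def k_def l_def)
  \<comment> \<open>The columns \<open>jl\<close>, \<open>kl\<close> and the rows \<open>ij\<close>,
    \<open>ik\<close> are used. Opposite edges being orthogonal, their 2 by 2 block is diagonal, and
    dividing by the diagonal entries inverts it.\<close>
  define E where "E s x y = (if s = 1 then pairing c m x y j l / pairing c m i j j l
      else pairing c m x y k l / pairing c m i k k l)" for s :: 2 and x y
  define F where "F s x y = (if s = 1 then pairing c m i j x y else pairing c m i k x y)"
    for s :: 2 and x y
  have E: "edge_cochain m (E s)" for s
    unfolding E_def divide_inverse
    by (cases "s = 1") (simp_all add: edge_cochain_scale[OF edge_cochain_pairing])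
  have "t.edge_cochain m (\<lambda>k l. pairing c m a b k l)" for a b
    unfolding pairing_transpose[of m a b]
    using t.edge_cochain_scale[OF t.edge_cochain_pairing, of m a b "- 1"] by simp
  then have F: "t.edge_cochain m (F s)" for s
    unfolding F_def by (cases "s = 1") simp_all
  have nz: "pairing c m i j j l \<noteq> 0" "pairing c m i k k l \<noteq> 0"
    using d by (auto intro!: pairing_adjacent_nonzero)
  have z: "pairing c m i j k l = 0" "pairing c m i k j l = 0"
    using d by (auto intro!: pairing_disjoint)
  \<comment> \<open>As a function of the first edge, the remainder is a cochain vanishing on
    \<open>ij\<close> and \<open>ik\<close>.\<close>
  have "pairing c m x y x' y' - E 1 x y * F 1 x' y' - E 2 x y * F 2 x' y' = 0"
    (is "?u x y = 0") for x y x' y'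
  proof (rule edge_cochain_eq_0[where u = ?u and m = m and i = i and j = j and k = k])
    show "edge_cochain m ?u"
      by (intro edge_cochain_diff edge_cochain_scale E edge_cochain_pairing)
  qed (use d nz z in \<open>simp_all add: E_def F_def\<close>)
  note vanish = this
  have "pairing c m x y x' y' = (\<Sum>s\<in>UNIV. E s x y * F s x' y')" for x y x' y'
    unfolding UNIV_2 using vanish[of x y x' y'] by (simp add: algebra_simps)
  with E F show ?thesis by blast
qed

end

subsection \<open>Spaces of delta function weights\<close>

text \<open>Double annihilation: if \<open>v\<close> lay outside the span, some functional would
  vanish on a basis of the span and take the value 1 at \<open>v\<close>.\<close>

lemma span_if_annihilated:
  fixes v :: "complex ^ 'n"
  assumes ann: "\<And>a. (\<And>s. s \<in> S \<Longrightarrow> (\<Sum>z\<in>UNIV. a z * s $ z) = 0) \<Longrightarrow> (\<Sum>z\<in>UNIV. a z * v $ z) = 0"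
  shows "v \<in> vec.span S"
proof (rule ccontr)
  assume "v \<notin> vec.span S"
  obtain B where B: "B \<subseteq> S" "vec.independent B" "S \<subseteq> vec.span B"
    using vec.maximal_independent_subset[of S] by blast
  have "v \<notin> vec.span B"
    using \<open>v \<notin> vec.span S\<close> vec.span_mono[OF B(1)] by blast
  then have "v \<notin> B" and "vec.independent (insert v B)"
    using B(2) vec.span_base vec.independent_insertI by blast+
  then obtain g :: "complex ^ 'n \<Rightarrow> complex ^ 1"
    where g: "Vector_Spaces.linear (*s) (*s) g"
      and gB: "\<And>x. x \<in> insert v B \<Longrightarrow> g x = (if x = v then vec 1 else 0)"
    using vec.linear_independent_extend[of "insert v B" "\<lambda>x. if x = v then vec 1 else 0"] by blast
  define a where "a z = g (axis z 1) $ 1" for z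
  have g_eq: "g x $ 1 = (\<Sum>z\<in>UNIV. a z * x $ z)" for x
  proof -
    have "g x = g (\<Sum>z\<in>UNIV. x $ z *s axis z 1)" by (simp add: basis_expansion)
    also have "\<dots> = (\<Sum>z\<in>UNIV. x $ z *s g (axis z 1))"
      by (simp add: vec.linear_sum[OF g] vec.linear_scale[OF g])
    finally show ?thesis by (simp add: a_def mult.commute)
  qed
  have "g s = 0" if "s \<in> S" for s
  proof (rule vec.linear_eq_0_on_span[OF g])
    show "g x = 0" if "x \<in> B" for x
      using that gB[of x] \<open>v \<notin> B\<close> by auto
  qed (use that B in blast)
  then have "(\<Sum>z\<in>UNIV. a z * v $ z) = 0"
    by (intro ann) (simp flip: g_eq)
  then show False
    using gB[of v] by (simp flip: g_eq)
qed

lemma annihilates_span: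
  assumes "r \<in> vec.span (range l)" and "\<And>i. annihilates a (l i)"
  shows "annihilates a r"
  using assms(1)
proof (rule vec.span_induct)
  show "vec.subspace {r. annihilates a r}"
    by (simp add: vec.subspace_def annihilates_def sum.distrib distrib_left mult.left_commute
        flip: sum_distrib_left)
qed (use assms(2) in auto)

lemma linear_mult_op: "Vector_Spaces.linear (*s) (*s) mult_op"
  unfolding Vector_Spaces.linear_iff
  by (auto simp: vec.vector_space_axioms mult_op_def vec_eq_iff split: sum.split)

lemma mult_op_sum: "mult_op (\<Sum>i\<in>A. r i) = (\<Sum>i\<in>A. mult_op (r i))"
  by (rule vec.linear_sum[OF linear_mult_op])

lemma mult_op_scale: "mult_op (k *s r) = k *s mult_op r"
  by (rule vec.linear_scale[OF linear_mult_op])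

lemma mult_op_eq_0_iff: "mult_op r = 0 \<longleftrightarrow> r = 0"
  by (auto simp: mult_op_def vec_eq_iff split: sum.split)

lemma deriv_op_sum: "deriv_op (\<lambda>z. \<Sum>i\<in>A. a i z) = (\<Sum>i\<in>A. deriv_op (a i))"
  by (auto simp: deriv_op_def vec_eq_iff split: sum.split)

lemma deriv_op_scale: "deriv_op (\<lambda>z. k * a z) = k *s deriv_op a"
  by (auto simp: deriv_op_def vec_eq_iff split: sum.split)

lemma deriv_op_eq_0_iff: "deriv_op a = 0 \<longleftrightarrow> a = (\<lambda>z. 0)"
  by (auto simp: deriv_op_def vec_eq_iff split: sum.split)

lemma mult_op_in_delta_space:
  assumes "r \<in> vec.span (range l)"
  shows "mult_op r \<in> delta_space l"
proof -
  have "mult_op r \<in> vec.span (mult_op ` range l)"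
    using assms vec.linear_span_image[OF linear_mult_op] by blast
  then show ?thesis
    unfolding delta_space_def image_image using vec.span_mono by blast
qed

lemma deriv_op_in_delta_space:
  assumes "\<And>i. annihilates a (l i)"
  shows "deriv_op a \<in> delta_space l"
  unfolding delta_space_def by (rule vec.span_base) (use assms in blast)

text \<open>The two halves of the coordinates separate: the conditions cut out a subspace containing
  all generators, and each of its elements is the sum of its multiplication part and its derivation
  part.\<close>

lemma delta_space_iff:
  "v \<in> delta_space l \<longleftrightarrow>
     (\<chi> z. v $ Inr z) \<in> vec.span (range l) \<and> (\<forall>i. annihilates (\<lambda>z. v $ Inl z) (l i))"
    (is "_ \<longleftrightarrow> ?R v")
proof
  have sub: "vec.subspace {v. ?R v}"
    unfolding vec.subspace_def
  proof (intro conjI ballI allI, goal_cases)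
    case 1
    have "(\<chi> z. (0 :: opr) $ Inr z) = (0 :: linform)" by (simp add: vec_eq_iff)
    then show ?case by (simp add: vec.span_zero annihilates_def)
  next
    case (2 x y)
    have "(\<chi> z. (x + y) $ Inr z) = (\<chi> z. x $ Inr z) + (\<chi> z. y $ Inr z)" by (simp add: vec_eq_iff)
    with 2 show ?case by (simp add: vec.span_add annihilates_def distrib_right sum.distrib)
  next
    case (3 k x)
    have "(\<chi> z. (k *s x) $ Inr z) = k *s (\<chi> z. x $ Inr z)" by (simp add: vec_eq_iff)
    with 3 show ?case
      by (simp add: vec.span_scale annihilates_def mult.assoc flip: sum_distrib_left)
  qed
  have gen: "range (\<lambda>i. mult_op (l i)) \<union> {deriv_op a |a. \<forall>i. annihilates a (l i)} \<subseteq> {v. ?R v}"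
  proof -
    have "(\<chi> z. mult_op r $ Inr z) = r" "(\<chi> z. deriv_op a $ Inr z) = 0" for r a
      by (simp_all add: mult_op_def deriv_op_def vec_eq_iff)
    then show ?thesis
      by (auto simp: vec.span_base vec.span_zero) (simp_all add: annihilates_def mult_op_def deriv_op_def)
  qed
  show "?R v" if "v \<in> delta_space l"
    using that vec.span_minimal[OF gen sub] by (auto simp: delta_space_def)
next
  assume R: "?R v"
  have "v = mult_op (\<chi> z. v $ Inr z) + deriv_op (\<lambda>z. v $ Inl z)"
    by (auto simp: mult_op_def deriv_op_def vec_eq_iff split: sum.split)
  moreover have "mult_op (\<chi> z. v $ Inr z) + deriv_op (\<lambda>z. v $ Inl z) \<in> delta_space l"
    using mult_op_in_delta_space[of "\<chi> z. v $ Inr z" l] deriv_op_in_delta_space[of "\<lambda>z. v $ Inl z" l] R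
    unfolding delta_space_def by (blast intro: vec.span_add)
  ultimately show "v \<in> delta_space l" by simp
qed

text \<open>Isotropy holds because the derivations annihilate the whole span of the forms. For
  maximality, testing against derivations puts the multiplication part into that span, and testing
  against the forms makes the derivation part annihilate them.\<close>

lemma lagrangian_delta_space: "lagrangian (delta_space l)"
  unfolding lagrangian_def
proof (intro conjI set_eqI iffI)
  show "vec.subspace (delta_space l)"
    by (simp add: delta_space_def vec.subspace_span)
next
  fix v assume v: "v \<in> delta_space l"
  have zero: "(\<Sum>z\<in>UNIV. v $ Inl z * w $ Inr z) = 0" if "v \<in> delta_space l" "w \<in> delta_space l" for v w
    using annihilates_span[of "\<chi> z. w $ Inr z" l "\<lambda>z. v $ Inl z"] that
    by (simp add: delta_space_iff annihilates_def)
  have "symp v w = 0" if "w \<in> delta_space l" for w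
    using zero[OF v that] zero[OF that v] by (simp add: symp_def sum_subtractf mult.commute)
  then show "v \<in> {v. \<forall>w\<in>delta_space l. symp v w = 0}" by blast
next
  fix v assume v: "v \<in> {v. \<forall>w\<in>delta_space l. symp v w = 0}"
  show "v \<in> delta_space l"
    unfolding delta_space_iff
  proof
    show "(\<chi> z. v $ Inr z) \<in> vec.span (range l)"
    proof (rule span_if_annihilated)
      fix a :: "bvar \<Rightarrow> complex"
      assume "\<And>s. s \<in> range l \<Longrightarrow> (\<Sum>z\<in>UNIV. a z * s $ z) = 0"
      then have "deriv_op a \<in> delta_space l"
        by (intro deriv_op_in_delta_space) (simp add: annihilates_def)
      with v have "symp v (deriv_op a) = 0" by blast
      then show "(\<Sum>z\<in>UNIV. a z * (\<chi> z. v $ Inr z) $ z) = 0"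
        by (simp add: symp_def deriv_op_def sum_negf mult.commute)
    qed
    show "\<forall>i. annihilates (\<lambda>z. v $ Inl z) (l i)"
    proof
      fix i
      have "mult_op (l i) \<in> delta_space l"
        by (intro mult_op_in_delta_space vec.span_base) simp
      with v have "symp v (mult_op (l i)) = 0" by blast
      then show "annihilates (\<lambda>z. v $ Inl z) (l i)"
        by (simp add: symp_def mult_op_def annihilates_def)
    qed
  qed
qed

lemma independent_range:
  fixes l :: "'i :: finite \<Rightarrow> complex ^ 'n"
  assumes "\<And>x. (\<Sum>i\<in>UNIV. x i *s l i) = 0 \<Longrightarrow> x = (\<lambda>i. 0)"
  shows "inj l" and "vec.independent (range l)"
proof -
  show inj: "inj l"
  proof (rule injI, rule ccontr)
    fix i j assume eq: "l i = l j" and ne: "i \<noteq> j"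
    define x where "x k = (if k = i then 1 else 0) - (if k = j then 1 else 0 :: complex)" for k
    have "(\<Sum>k\<in>UNIV. x k *s l k) =
        (\<Sum>k\<in>UNIV. (if k = i then l k else 0)) - (\<Sum>k\<in>UNIV. (if k = j then l k else 0))"
      unfolding sum_subtractf[symmetric] by (intro sum.cong refl) (simp add: x_def)
    then have "(\<Sum>k\<in>UNIV. x k *s l k) = 0" using eq by simp
    then have "x i = 0" using assms by metis
    then show False using ne by (simp add: x_def)
  qed
  show "vec.independent (range l)"
  proof (rule vec.independent_if_scalars_zero)
    fix u v assume "(\<Sum>v\<in>range l. u v *s v) = 0" and v: "v \<in> range l"
    then have "(\<Sum>i\<in>UNIV. u (l i) *s l i) = 0"
      by (simp add: sum.reindex[OF inj])
    then have "(\<lambda>i. u (l i)) = (\<lambda>i. 0)" by (rule assms)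
    with v show "u v = 0" by (auto dest: fun_cong)
  qed simp
qed

subsection \<open>Edge operators\<close>

definition opposite :: "tetra \<Rightarrow> vertex" where
  "opposite t = (THE m. tetra_vertices t = - {m})"

lemma tetra_vertices_eq: "tetra_vertices t = - {opposite t}"
proof -
  have "card (- tetra_vertices t) = 1"
    using tetra_vertices[of t] by (simp add: Compl_eq_Diff_UNIV card_Diff_subset)
  then obtain m where "- tetra_vertices t = {m}"
    by (meson card_1_singletonE)
  then have "tetra_vertices t = - {m}" by blast
  then show ?thesis
    unfolding opposite_def by (rule theI) (use \<open>tetra_vertices t = - {m}\<close> in auto)
qed

text \<open>Lets a sum over tetrahedra be read as a sum over \<open>m\<close>, as in
  \<open>edge_form_sum_opposite\<close>.\<close>

lemma bij_opposite: "bij opposite"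
proof (rule bijI)
  show "inj opposite"
    by (rule injI) (metis tetra_vertices_eq tetra_vertices_inject)
  show "surj opposite"
  proof (rule surjI)
    fix m :: vertex
    have "card (- {m}) = 4" by (simp add: Compl_eq_Diff_UNIV)
    then have "tetra_vertices (Abs_tetra (- {m})) = - {m}"
      by (simp add: Abs_tetra_inverse)
    then show "opposite (Abs_tetra (- {m})) = m"
      using tetra_vertices_eq[of "Abs_tetra (- {m})"] by simp
  qed
qed

lemma UNIV_5: "(UNIV :: 5 set) = {1, 2, 3, 4, 5}"
proof -
  have "card {1 :: 5, 2, 3, 4, 5} = card (UNIV :: 5 set)" by simp
  then show ?thesis
    using card_subset_eq[of UNIV "{1 :: 5, 2, 3, 4, 5}"] by (metis finite subset_UNIV)
qed

text \<open>The factorizations of the five tetrahedra are glued: \<open>E m\<close> and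
  \<open>F m\<close> give the components in the two variables of the tetrahedron opposite to
  \<open>m\<close>. The last two claims isolate the pairing of a single tetrahedron, in order to
  detect nonzero operators and independence.\<close>

lemma (in edge_weight) edge_operator_families:
  obtains e :: "vertex \<Rightarrow> vertex \<Rightarrow> linform" and f :: "vertex \<Rightarrow> vertex \<Rightarrow> bvar \<Rightarrow> complex"
  where "\<And>i j. e j i = c j i *s e i j" and "\<And>i. (\<Sum>j\<in>UNIV. e i j) = 0" and "\<And>i. e i i = 0"
    and "\<And>i j t s. opposite t \<in> {i, j} \<Longrightarrow> e i j $ (t, s) = 0"
    and "\<And>i j z. f j i z = c i j * f i j z" and "\<And>i z. (\<Sum>j\<in>UNIV. f i j z) = 0" and "\<And>i z. f i i z = 0"
    and "\<And>i j t s. opposite t \<in> {i, j} \<Longrightarrow> f i j (t, s) = 0"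
    and "\<And>i j k l. annihilates (f k l) (e i j)"
    and "\<And>m k l. \<exists>a. \<forall>i j. (\<Sum>z\<in>UNIV. a z * e i j $ z) = pairing c m i j k l"
    and "\<And>m i j. \<exists>a. \<forall>k l. (\<Sum>z\<in>UNIV. f k l z * a z) = pairing c m i j k l"
proof -
  interpret t: edge_weight "\<lambda>x y. c y x" by (rule edge_weight_transpose)
  define factors where "factors m E F \<longleftrightarrow>
      (\<forall>s. edge_cochain m (E s) \<and> t.edge_cochain m (F s)) \<and>
      (\<forall>x y x' y'. pairing c m x y x' y' = (\<Sum>s\<in>UNIV. E s x y * F s x' y'))"
    for m and E F :: "2 \<Rightarrow> vertex \<Rightarrow> vertex \<Rightarrow> complex"
  have "\<forall>m. \<exists>E F. factors m E F"
    unfolding factors_def by (rule allI) (rule pairing_factorization)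
  then obtain E F where "factors m (E m) (F m)" for m by metis
  note EF = this[unfolded factors_def]
  have E: "edge_cochain m (E m s)" and F: "t.edge_cochain m (F m s)"
    and P: "pairing c m x y x' y' = (\<Sum>s\<in>UNIV. E m s x y * F m s x' y')" for m s x y x' y'
    by (rule EF[THEN conjunct1, THEN spec, THEN conjunct1] EF[THEN conjunct1, THEN spec, THEN conjunct2] EF[THEN conjunct2, rule_format])+
  define e :: "vertex \<Rightarrow> vertex \<Rightarrow> linform"
    where "e i j = (\<chi> z. E (opposite (fst z)) (snd z) i j)" for i j
  define f :: "vertex \<Rightarrow> vertex \<Rightarrow> bvar \<Rightarrow> complex"
    where "f i j z = F (opposite (fst z)) (snd z) i j" for i j z
  have sum_z: "(\<Sum>z\<in>UNIV. g z) = (\<Sum>t\<in>UNIV. \<Sum>s\<in>UNIV. g (t, s))" for g :: "bvar \<Rightarrow> complex"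
    by (simp add: sum.cartesian_product UNIV_Times_UNIV)
  have sum_t: "(\<Sum>t\<in>UNIV. g (opposite t)) = (\<Sum>m\<in>UNIV. g m)" for g :: "vertex \<Rightarrow> complex"
    by (rule sum.reindex_bij_betw[OF bij_opposite])
  have sum_t': "(\<Sum>t\<in>UNIV. if opposite t = m then g (opposite t) else 0) = g m"
    for g :: "vertex \<Rightarrow> complex" and m
    using sum_t[of "\<lambda>n. if n = m then g n else 0"] by simp
  show thesis
  proof (rule that[of e f])
    show "e j i = c j i *s e i j" for i j
      by (simp add: e_def vec_eq_iff edge_cochainD(1)[OF E, of _ _ j i])
    show "(\<Sum>j\<in>UNIV. e i j) = 0" "e i i = 0" for i
      by (simp_all add: e_def vec_eq_iff edge_cochainD(2,4)[OF E])
    show "f j i z = c i j * f i j z" for i j z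
      unfolding f_def by (rule t.edge_cochainD(1)[OF F])
    show "(\<Sum>j\<in>UNIV. f i j z) = 0" "f i i z = 0" for i z
      by (simp_all add: f_def t.edge_cochainD(2,4)[OF F])
    have "u i j = 0" if "edge_weight c" "edge_weight.edge_cochain c m u" "m \<in> {i, j}" for c m u i j
      using edge_weight.edge_cochainD(1)[OF that(1,2), of i j]
        edge_weight.edge_cochainD(3)[OF that(1,2)] that(3) by (elim insertE emptyE) simp_all
    note vanish = this[OF edge_weight_axioms E] this[OF edge_weight_transpose F]
    show "e i j $ (t, s) = 0" "f i j (t, s) = 0" if "opposite t \<in> {i, j}" for i j t s
      using vanish that by (simp_all add: e_def f_def)
    show "annihilates (f k l) (e i j)" for i j k l
    proof -
      have "(\<Sum>z\<in>UNIV. f k l z * e i j $ z) = (\<Sum>t\<in>UNIV. pairing c (opposite t) i j k l)"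
        by (simp add: sum_z P e_def f_def mult.commute)
      also have "\<dots> = (\<Sum>m\<in>UNIV. pairing c m i j k l)"
        by (rule sum_t)
      also have "\<dots> = 0"
        unfolding pairing_def by (rule edge_form_sum_opposite)
      finally show ?thesis by (simp only: annihilates_def)
    qed
    show "\<exists>a. \<forall>i j. (\<Sum>z\<in>UNIV. a z * e i j $ z) = pairing c m i j k l" for m k l
    proof (intro exI allI)
      fix i j
      \<comment> \<open>The functional is \<open>f k l\<close> cut down to the variables of one
        tetrahedron.\<close>
      show "(\<Sum>z\<in>UNIV. (if opposite (fst z) = m then f k l z else 0) * e i j $ z) = pairing c m i j k l"
        unfolding sum_z P sum_t'[of m "\<lambda>m. \<Sum>s\<in>UNIV. E m s i j * F m s k l", symmetric]
        by (intro sum.cong refl) (simp add: e_def f_def mult.commute)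
    qed
    show "\<exists>a. \<forall>k l. (\<Sum>z\<in>UNIV. f k l z * a z) = pairing c m i j k l" for m i j
    proof (intro exI allI)
      fix k l
      show "(\<Sum>z\<in>UNIV. f k l z * (if opposite (fst z) = m then e i j $ z else 0)) = pairing c m i j k l"
        unfolding sum_z P sum_t'[of m "\<lambda>m. \<Sum>s\<in>UNIV. E m s i j * F m s k l", symmetric]
        by (intro sum.cong refl) (simp add: e_def f_def mult.commute)
    qed
  qed
qed

text \<open>All edges but those of the triangle \<open>123\<close> and \<open>14\<close>, \<open>15\<close>. The relations at
  \<open>4\<close> and \<open>5\<close> recover \<open>14\<close> and \<open>15\<close>; those at \<open>1, 2, 3\<close> then determine the triangle because its
  holonomy is not \<open>-1\<close>.\<close>

definition five_edges :: "(vertex \<Rightarrow> vertex \<Rightarrow> 'b) \<Rightarrow> 5 \<Rightarrow> 'b" where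
  "five_edges e i = (if i = 1 then e 2 4 else if i = 2 then e 3 4 else if i = 3 then e 2 5
     else if i = 4 then e 3 5 else e 4 5)"

context edge_weight
begin

lemma five_edges_independent:
  assumes "\<And>m k l. \<exists>a. \<forall>i j. (\<Sum>z\<in>UNIV. a z * e i j $ z) = pairing c m i j k l"
    and zero: "(\<Sum>i\<in>UNIV. x i *s five_edges e i) = (0 :: linform)"
  shows "x = (\<lambda>i. 0)"
proof -
  have *: "x 1 * pairing c m 2 4 k l + x 2 * pairing c m 3 4 k l + x 3 * pairing c m 2 5 k l +
      x 4 * pairing c m 3 5 k l + x 5 * pairing c m 4 5 k l = 0" for m k l
  proof -
    obtain a where a: "\<And>i j. (\<Sum>z\<in>UNIV. a z * e i j $ z) = pairing c m i j k l"
      using assms(1) by meson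
    have lin: "(\<Sum>z\<in>UNIV. a z * (y *s v) $ z) = y * (\<Sum>z\<in>UNIV. a z * v $ z)" for y v
      by (simp add: sum_distrib_left mult_ac)
    have "0 = (\<Sum>z\<in>UNIV. a z * (\<Sum>i\<in>UNIV. x i *s five_edges e i) $ z)"
      by (simp add: zero)
    also have "\<dots> = (\<Sum>i\<in>UNIV. \<Sum>z\<in>UNIV. a z * (x i *s five_edges e i) $ z)"
      by (subst sum.swap) (simp add: sum_distrib_left)
    also have "\<dots> = (\<Sum>i\<in>UNIV. x i * (\<Sum>z\<in>UNIV. a z * five_edges e i $ z))"
      by (simp only: lin)
    finally show ?thesis
      unfolding UNIV_5 by (simp add: five_edges_def a add.assoc)
  qed
  have out: "pairing c m i j k l = 0" if "m = i \<or> m = j" for m i j k l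
    using edge_cochainD(1,3)[OF edge_cochain_pairing] that by (metis mult_zero_right)
  note simps = out pairing_disjoint pairing_adjacent_nonzero
  \<comment> \<open>Each choice of \<open>m\<close>, \<open>k\<close>, \<open>l\<close> leaves one
    unknown: edges through \<open>m\<close> and edges disjoint from \<open>kl\<close> drop out. The
    choice for \<open>x 5\<close> also relies on \<open>x 1 = 0\<close>.\<close>
  have "x 1 = 0" using *[of 5 2 1] by (simp add: simps)
  moreover have "x 2 = 0" using *[of 5 3 1] by (simp add: simps)
  moreover have "x 3 = 0" using *[of 4 2 1] by (simp add: simps)
  moreover have "x 4 = 0" using *[of 4 3 1] by (simp add: simps)
  moreover have "x 5 = 0" using *[of 3 4 1] calculation by (simp add: simps)
  ultimately have "\<forall>i\<in>{1, 2, 3, 4, 5}. x i = 0" by blast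
  then show ?thesis by (simp add: fun_eq_iff flip: UNIV_5)
qed

lemma five_edges_span:
  fixes e :: "vertex \<Rightarrow> vertex \<Rightarrow> linform"
  assumes swap: "\<And>i j. e j i = c j i *s e i j" and sum0: "\<And>i. (\<Sum>j\<in>UNIV. e i j) = 0"
    and diag: "\<And>i. e i i = 0"
  shows "e i j \<in> vec.span (range (five_edges e))"
proof -
  let ?V = "vec.span (range (five_edges e))"
  have rev: "e j i \<in> ?V" if "e i j \<in> ?V" for i j
    by (subst swap) (rule vec.span_scale[OF that])
  have base: "e 2 4 \<in> ?V" "e 3 4 \<in> ?V" "e 2 5 \<in> ?V" "e 3 5 \<in> ?V" "e 4 5 \<in> ?V"
  proof -
    have "five_edges e i \<in> ?V" for i by (simp add: vec.span_base)
    from this[of 1] this[of 2] this[of 3] this[of 4] this[of 5]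
    show "e 2 4 \<in> ?V" "e 3 4 \<in> ?V" "e 2 5 \<in> ?V" "e 3 5 \<in> ?V" "e 4 5 \<in> ?V"
      by (simp_all add: five_edges_def)
  qed
  note base' = base[THEN rev]
  have row: "e i 1 + e i 2 + e i 3 + e i 4 + e i 5 = 0" for i
    using sum0[of i] unfolding UNIV_5 by (simp add: add_ac)
  have neg: "u \<in> ?V" if "u + v = 0" "v \<in> ?V" for u v
  proof -
    have "u = - v" using that(1) by (simp add: eq_neg_iff_add_eq_0)
    then show ?thesis using vec.span_neg[OF that(2)] by simp
  qed
  have e41: "e 4 1 \<in> ?V"
    by (rule neg[where v = "e 4 2 + e 4 3 + e 4 5"]) (use row[of 4] diag[of 4] in \<open>simp add: add.assoc\<close>, intro vec.span_add base base')
  have e51: "e 5 1 \<in> ?V"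
    by (rule neg[where v = "e 5 2 + e 5 3 + e 5 4"]) (use row[of 5] diag[of 5] in \<open>simp add: add.assoc\<close>, intro vec.span_add base base')
  have p1: "e 1 2 + e 1 3 \<in> ?V"
    by (rule neg[where v = "e 1 4 + e 1 5"]) (use row[of 1] diag[of 1] in \<open>simp add: add.assoc\<close>, intro vec.span_add e41[THEN rev] e51[THEN rev])
  have p2: "e 2 1 + e 2 3 \<in> ?V"
    by (rule neg[where v = "e 2 4 + e 2 5"]) (use row[of 2] diag[of 2] in \<open>simp add: add.assoc\<close>, intro vec.span_add base)
  have p3: "e 3 1 + e 3 2 \<in> ?V"
    by (rule neg[where v = "e 3 4 + e 3 5"]) (use row[of 3] diag[of 3] in \<open>simp add: add.assoc\<close>, intro vec.span_add base)
  \<comment> \<open>The coefficients cancel \<open>e 1 3\<close> and \<open>e 2 3\<close>, leaving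
    \<open>e 1 2\<close> with the factor \<open>c 3 1 * (1 + holonomy c 3 2 1)\<close>.\<close>
  have "c 3 1 *s (e 1 2 + e 1 3) + c 3 2 *s (e 2 1 + e 2 3) - (e 3 1 + e 3 2) \<in> ?V"
    by (intro vec.span_add vec.span_diff vec.span_scale p1 p2 p3)
  also have "c 3 1 *s (e 1 2 + e 1 3) + c 3 2 *s (e 2 1 + e 2 3) - (e 3 1 + e 3 2) =
      (c 3 1 + c 3 2 * c 2 1) *s e 1 2"
    unfolding swap[where j = 2 and i = 1] swap[where j = 3 and i = 1] swap[where j = 3 and i = 2]
    by (simp add: vec_eq_iff algebra_simps)
  finally have "(c 3 1 + c 3 2 * c 2 1) *s e 1 2 \<in> ?V" .
  moreover have "c 3 1 * (1 + holonomy c 3 2 1) = c 3 1 + c 3 2 * c 2 1"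
    using c_inverse[of 3 1] by (simp add: holonomy_def algebra_simps)
  then have "c 3 1 + c 3 2 * c 2 1 \<noteq> 0"
    by (metis c_nonzero mult_eq_0_iff one_plus_holonomy)
  ultimately have e12: "e 1 2 \<in> ?V"
    by (metis vec.span_scale vector_smult_assoc left_inverse vector_smult_lid)
  have e13: "e 1 3 \<in> ?V"
    using vec.span_diff[OF p1 e12] by simp
  have e23: "e 2 3 \<in> ?V"
    using vec.span_diff[OF p2 rev[OF e12]] by simp
  have "\<forall>i\<in>{1, 2, 3, 4, 5}. \<forall>j\<in>{1, 2, 3, 4, 5}. e i j \<in> ?V"
    using base base' e41 e51 e41[THEN rev] e51[THEN rev] e12 e13 e23 e12[THEN rev] e13[THEN rev] e23[THEN rev]
    by (simp add: diag vec.span_zero)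
  then show ?thesis by (simp flip: UNIV_5)
qed

end

section \<open>From the cocycle to the weight\<close>

lemma mult_cocycle_coboundary:
  assumes \<omega>: "mult_cocycle \<omega>" and neq: "\<And>i j k. distinct [i, j, k] \<Longrightarrow> \<omega> i j k \<noteq> - 1"
  obtains c where "edge_weight c" and "\<And>i j k. distinct [i, j, k] \<Longrightarrow> \<omega> i j k = holonomy c i j k"
proof -
  \<comment> \<open>A cocycle on a simplex is a coboundary by coning from vertex 1: an edge at 1
    gets weight 1, any other edge the value of the triangle joining it to 1.\<close>
  define c where "c i j = (if i = j \<or> i = 1 \<or> j = 1 then 1 else \<omega> 1 i j)" for i j
  have nz: "\<omega> i j k \<noteq> 0" and cyc: "\<omega> j k i = \<omega> i j k" and inv: "\<omega> j i k = inverse (\<omega> i j k)"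
    if "distinct [i, j, k]" for i j k
    using \<omega> that unfolding mult_cocycle_def by blast+
  have coc: "\<omega> i j k * \<omega> i k l = \<omega> i j l * \<omega> j k l" if "distinct [i, j, k, l]" for i j k l
    using \<omega> that unfolding mult_cocycle_def by blast
  have inv': "\<omega> i k j = inverse (\<omega> i j k)" if "distinct [i, j, k]" for i j k
  proof -
    have "\<omega> k j i = \<omega> i k j" and "\<omega> j i k = \<omega> k j i" and "\<omega> j i k = inverse (\<omega> i j k)"
      using that by (auto intro!: cyc inv)
    then show ?thesis by metis
  qed
  have cinv: "c i j * c j i = 1" for i j
    using inv'[of 1 i j] nz[of 1 i j] nz[of 1 j i] by (auto simp: c_def)
  have hol: "\<omega> i j k = holonomy c i j k" if d: "distinct [i, j, k]" for i j k
  proof -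
    \<comment> \<open>Triangles at vertex 1 are settled by construction and cyclic invariance; the
      remaining ones use the cocycle identity on \<open>1, i, j, k\<close>.\<close>
    consider "i = 1" | "j = 1" | "k = 1" | "distinct [1, i, j, k]"
      using d by auto
    then show ?thesis
    proof cases
      case 4
      then have "\<omega> 1 i j * \<omega> 1 j k = \<omega> 1 i k * \<omega> i j k" "\<omega> 1 k i = inverse (\<omega> 1 i k)" "\<omega> 1 i k \<noteq> 0"
        by (auto intro!: coc inv' nz)
      then have "\<omega> i j k = \<omega> 1 i j * \<omega> 1 j k * \<omega> 1 k i" by (simp add: field_simps)
      then show ?thesis using 4 by (auto simp: holonomy_def c_def)
    qed (use d cyc[of i 1 k] cyc[of 1 i j] in \<open>auto simp: holonomy_def c_def\<close>)
  qed
  have "edge_weight c"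
  proof
    show "c x x = 1" for x by (simp add: c_def)
    show "c x y * c y x = 1" for x y by (rule cinv)
    show "holonomy c x y z \<noteq> -1" for x y z
    proof (cases "distinct [x, y, z]")
      case True
      then show ?thesis using hol neq by metis
    next
      case False
      then have "holonomy c x y z = 1"
        using cinv[of x y] cinv[of y z] cinv[of z x] by (auto simp: holonomy_def c_def)
      then show ?thesis by simp
    qed
  qed
  then show thesis using hol by (rule that)
qed

lemma corresponds_delta_space:
  assumes "edge_weight c"
    and \<omega>: "\<And>i j k. distinct [i, j, k] \<Longrightarrow> \<omega> i j k = holonomy c i j k"
  obtains l where "inj l" and "vec.independent (range l)" and "corresponds \<omega> (delta_space l)"
proof -
  interpret edge_weight c by fact
  obtain e :: "vertex \<Rightarrow> vertex \<Rightarrow> linform" and f :: "vertex \<Rightarrow> vertex \<Rightarrow> bvar \<Rightarrow> complex"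
    where e: "\<And>i j. e j i = c j i *s e i j" "\<And>i. (\<Sum>j\<in>UNIV. e i j) = 0" "\<And>i. e i i = 0"
        "\<And>i j t s. opposite t \<in> {i, j} \<Longrightarrow> e i j $ (t, s) = 0"
      and f: "\<And>i j z. f j i z = c i j * f i j z" "\<And>i z. (\<Sum>j\<in>UNIV. f i j z) = 0" "\<And>i z. f i i z = 0"
        "\<And>i j t s. opposite t \<in> {i, j} \<Longrightarrow> f i j (t, s) = 0"
      and ann: "\<And>i j k l. annihilates (f k l) (e i j)"
      and ep: "\<And>m k l. \<exists>a. \<forall>i j. (\<Sum>z\<in>UNIV. a z * e i j $ z) = pairing c m i j k l"
      and fp: "\<And>m i j. \<exists>a. \<forall>k l. (\<Sum>z\<in>UNIV. f k l z * a z) = pairing c m i j k l"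
    by (rule edge_operator_families, rule that)
  let ?W = "delta_space (five_edges e)"
  \<comment> \<open>An adjacent edge in a common tetrahedron has nonzero pairing with
    \<open>ij\<close>.\<close>
  have neq0: "e i j \<noteq> 0" "f i j \<noteq> (\<lambda>z. 0)" if ne: "i \<noteq> j" for i j
  proof -
    obtain k m where km: "distinct [m, i, j, k]"
    proof -
      have "card (- {i, j}) = 3"
        using ne by (simp add: Compl_eq_Diff_UNIV card_Diff_subset)
      then obtain k m n where "- {i, j} = {k, m, n}" "k \<noteq> m"
        by (metis card_3_iff)
      then show ?thesis using ne that[of m k] by auto
    qed
    have "pairing c m i j i k \<noteq> 0" "pairing c m i k i j \<noteq> 0"
      using km by (auto intro!: pairing_adjacent_nonzero)
    moreover obtain a where "(\<Sum>z\<in>UNIV. a z * e i j $ z) = pairing c m i j i k"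
      using ep by meson
    moreover obtain b where "(\<Sum>z\<in>UNIV. f i j z * b z) = pairing c m i k i j"
      using fp by meson
    ultimately show "e i j \<noteq> 0" "f i j \<noteq> (\<lambda>z. 0)" by auto
  qed
  have eW: "mult_op (e i j) \<in> ?W" for i j
    by (rule mult_op_in_delta_space, rule five_edges_span[OF e(1-3)])
  have fW: "deriv_op (f i j) \<in> ?W" for i j
    by (rule deriv_op_in_delta_space) (simp add: five_edges_def ann)
  \<comment> \<open>Only the ratio \<open>\<gamma> i j / \<gamma> j i = c i j\<close> matters; here
    the whole weight sits on the orientation against the vertex order.\<close>
  define \<gamma> where "\<gamma> i j = (if i < j then 1 else c i j)" for i j
  \<comment> \<open>An unoriented edge is represented by its increasing orientation, on which
    \<open>\<gamma>\<close> is 1.\<close>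
  define e' where "e' b = mult_op (e (Min b) (Max b))" for b
  define f' where "f' b = deriv_op (f (Min b) (Max b))" for b
  have \<gamma>0: "\<gamma> i j \<noteq> 0" for i j by (simp add: \<gamma>_def)
  have c_inv: "inverse (c i j) = c j i" for i j
    by (rule inverse_unique) (rule c_inverse)
  have \<gamma>_ratio: "\<gamma> i j * inverse (\<gamma> j i) = c i j" if "i \<noteq> j" for i j
    using that by (cases i j rule: linorder_cases) (auto simp: \<gamma>_def c_inv)
  have minmax: "Min {i, j} = i" "Max {i, j} = j" "Min {j, i} = i" "Max {j, i} = j"
    if "i < j" for i j :: vertex
    using that by (simp_all add: min_absorb1 min_absorb2 max_absorb1 max_absorb2 less_imp_le)
  have e': "\<gamma> i j *s e' {i, j} = mult_op (e i j)" if "i \<noteq> j" for i j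
  proof (cases "i < j")
    case True
    then show ?thesis by (simp add: \<gamma>_def e'_def minmax)
  next
    case False
    with that have "j < i" by simp
    then have "\<gamma> i j *s e' {i, j} = mult_op (c i j *s e j i)"
      using False by (simp add: \<gamma>_def e'_def minmax mult_op_scale)
    also have "c i j *s e j i = e i j" by (rule e(1)[symmetric])
    finally show ?thesis .
  qed
  have f': "inverse (\<gamma> i j) *s f' {i, j} = deriv_op (f i j)" if "i \<noteq> j" for i j
  proof (cases "i < j")
    case True
    then show ?thesis by (simp add: \<gamma>_def f'_def minmax)
  next
    case False
    with that have "j < i" by simp
    then have "inverse (\<gamma> i j) *s f' {i, j} = deriv_op (\<lambda>z. c j i * f j i z)"
      using False by (simp add: \<gamma>_def f'_def minmax deriv_op_scale c_inv)
    also have "(\<lambda>z. c j i * f j i z) = f i j" by (rule ext) (rule f(1)[symmetric])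
    finally show ?thesis .
  qed
  have "corresponds \<omega> ?W"
    unfolding corresponds_def
  proof (rule exI[of _ e'], rule exI[of _ f'], rule exI[of _ \<gamma>], intro conjI ballI allI impI)
    fix b assume "b \<in> edges"
    then have "card b = 2" by (simp add: edges_def)
    then obtain i j where b: "b = {i, j}" "i < j"
      by (metis card_2_iff insert_commute linorder_neqE)
    then have ef: "e' b = mult_op (e i j)" "f' b = deriv_op (f i j)"
      by (simp_all add: e'_def f'_def minmax)
    have supp: "opposite t \<in> {i, j}" if "\<not> b \<subseteq> tetra_vertices t" for t
      using that b by (auto simp: tetra_vertices_eq)
    show "e' b \<in> edge_ops ?W b"
      unfolding edge_ops_def ef using eW supp e(4) by (simp add: mult_op_def)
    show "f' b \<in> edge_ops ?W b"
      unfolding edge_ops_def ef using fW supp f(4) by (simp add: deriv_op_def)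
    have nz: "e' b \<noteq> 0" "f' b \<noteq> 0"
      using neq0[of i j] less_imp_neq[OF b(2)] by (simp_all add: ef mult_op_eq_0_iff deriv_op_eq_0_iff)
    \<comment> \<open>\<open>e' b\<close> is a multiplication and \<open>f' b\<close> a derivation,
      so their coordinates have disjoint supports.\<close>
    have ind: "x = 0 \<and> y = 0" if "x *s e' b + y *s f' b = 0" for x y
    proof -
      have "x *s e' b = 0" "y *s f' b = 0"
        using that by (auto simp: vec_eq_iff ef mult_op_def deriv_op_def split: sum.splits)
      with nz show ?thesis by simp
    qed
    show ne: "e' b \<noteq> f' b"
      using ind[of 1 "-1"] by auto
    show "vec.independent {e' b, f' b}"
    proof (rule vec.independent_if_scalars_zero)
      fix g x assume "(\<Sum>x\<in>{e' b, f' b}. g x *s x) = 0" "x \<in> {e' b, f' b}"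
      then show "g x = 0" using ne ind[of "g (e' b)" "g (f' b)"] by auto
    qed simp
  next
    fix i
    have "(\<Sum>j\<in>UNIV - {i}. \<gamma> i j *s e' {i, j}) = (\<Sum>j\<in>UNIV - {i}. mult_op (e i j))"
      by (intro sum.cong refl e') auto
    also have "\<dots> = (\<Sum>j\<in>UNIV. mult_op (e i j))"
      by (rule sum.mono_neutral_left) (auto simp: e(3) mult_op_eq_0_iff)
    also have "\<dots> = 0"
      by (simp add: e(2) mult_op_eq_0_iff flip: mult_op_sum)
    finally show "(\<Sum>j\<in>UNIV - {i}. \<gamma> i j *s e' {i, j}) = 0" .
    have "(\<Sum>j\<in>UNIV - {i}. inverse (\<gamma> i j) *s f' {i, j}) = (\<Sum>j\<in>UNIV - {i}. deriv_op (f i j))"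
      by (intro sum.cong refl f') auto
    also have "\<dots> = (\<Sum>j\<in>UNIV. deriv_op (f i j))"
      by (rule sum.mono_neutral_left) (auto simp: f(3) deriv_op_eq_0_iff)
    also have "\<dots> = 0"
      by (simp add: f(2) deriv_op_eq_0_iff flip: deriv_op_sum)
    finally show "(\<Sum>j\<in>UNIV - {i}. inverse (\<gamma> i j) *s f' {i, j}) = 0" .
  next
    fix i j k :: vertex assume d: "distinct [i, j, k]"
    have "\<omega> i j k = (\<gamma> i j * inverse (\<gamma> j i)) * (\<gamma> j k * inverse (\<gamma> k j)) * (\<gamma> k i * inverse (\<gamma> i k))"
      using d by (auto simp: \<omega> holonomy_def \<gamma>_ratio)
    then show "\<omega> i j k = inverse (\<gamma> j i) * \<gamma> j k * inverse (\<gamma> k j) * \<gamma> k i * inverse (\<gamma> i k) * \<gamma> i j"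
      by (simp only: mult_ac)
  qed (rule \<gamma>0)
  moreover have "inj (five_edges e)" "vec.independent (range (five_edges e))"
    by (rule independent_range; rule five_edges_independent[OF ep]; assumption)+
  ultimately show thesis by (intro that)
qed

theorem mainTheorem6:
  fixes \<omega> :: "vertex \<Rightarrow> vertex \<Rightarrow> vertex \<Rightarrow> complex"
  assumes "mult_cocycle \<omega>"
    and "\<And>i j k. distinct [i, j, k] \<Longrightarrow> \<omega> i j k \<noteq> - 1"
  shows "(\<exists>W. lagrangian W \<and> corresponds \<omega> W) \<and>
    (\<exists>l :: 5 \<Rightarrow> linform. inj l \<and> vec.independent (range l) \<and>
       lagrangian (delta_space l) \<and> corresponds \<omega> (delta_space l))"
proof -
  obtain c where "edge_weight c" and "\<And>i j k. distinct [i, j, k] \<Longrightarrow> \<omega> i j k = holonomy c i j k"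
    using mult_cocycle_coboundary[OF assms] by metis
  then obtain l where "inj l" "vec.independent (range l)" "corresponds \<omega> (delta_space l)"
    using corresponds_delta_space by blast
  then show ?thesis using lagrangian_delta_space by blast
qed

end
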